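(* Let $\rho_0 \in [0,\tfrac12]$ and let $X_1, X_2, \ldots$ be i.i.d. random variables with $\mathbb{P}(X_i = 0) = \rho_0$ and $\mathbb{P}(X_i = 1) = \mathbb{P}(X_i = -1) = \frac{1-\rho_0}{2}$. For a positive integer $n$, $p \ge 1$ and $a = (a_1,\ldots,a_n) \in \mathbb{R}^n$, let $N_p(a) = \left(\mathbb{E}\left|\sum_{i=1}^n a_i X_i\right|^p\right)^{1/p}$. If $p \geq 3$, then for every $n$ the function $$(a_1,\ldots,a_n) \mapsto N_p(\sqrt{a_1},\ldots,\sqrt{a_n})$$ is Schur-concave on $[0,+\infty)^n$.
   Context: A function $\Phi\colon [0,\infty)^n \to \mathbb{R}$ is Schur-concave if $\Phi(x) \ge \Phi(y)$ whenever $x$ is majorised by $y$, i.e. whenever $\sum_{i=1}^n x_i = \sum_{i=1}^n y_i$ and, for each $k = 1,\ldots,n$, the sum of the $k$ largest coordinates of $x$ is at most the sum of the $k$ largest coordinates of $y$. *)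

theory Defs
  imports "HOL-Probability.Probability"
begin

(* A vector of R^n is an element of {..<n} \<rightarrow>\<^sub>E UNIV: coordinates are indexed by 0, ..., n - 1, and the
   extensional function space makes the representation unique. *)

definition sum_largest :: "nat \<Rightarrow> nat \<Rightarrow> (nat \<Rightarrow> real) \<Rightarrow> real" where
  "sum_largest n k x = sum_list (take k (rev (sort (map x [0..<n]))))"

definition majorised_by :: "nat \<Rightarrow> (nat \<Rightarrow> real) \<Rightarrow> (nat \<Rightarrow> real) \<Rightarrow> bool" where
  "majorised_by n x y \<longleftrightarrow>
     (\<Sum>i<n. x i) = (\<Sum>i<n. y i) \<and> (\<forall>k\<in>{1..n}. sum_largest n k x \<le> sum_largest n k y)"

definition schur_concave :: "nat \<Rightarrow> ((nat \<Rightarrow> real) \<Rightarrow> real) \<Rightarrow> bool" where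
  "schur_concave n \<Phi> \<longleftrightarrow>
     (\<forall>x \<in> {..<n} \<rightarrow>\<^sub>E {0..}. \<forall>y \<in> {..<n} \<rightarrow>\<^sub>E {0..}. majorised_by n x y \<longrightarrow> \<Phi> x \<ge> \<Phi> y)"

(* X 0, X 1, ... play the role of X_1, X_2, ... .  Both powers have nonnegative base, where
   0 powr p = 0 is the intended value for p > 0. *)
definition moment_norm ::
    "'w measure \<Rightarrow> (nat \<Rightarrow> 'w \<Rightarrow> real) \<Rightarrow> nat \<Rightarrow> real \<Rightarrow> (nat \<Rightarrow> real) \<Rightarrow> real" where
  "moment_norm M X n p a =
     (prob_space.expectation M (\<lambda>\<omega>. \<bar>\<Sum>i<n. a i * X i \<omega>\<bar> powr p)) powr (1 / p)"

end

(* Majorisation is generated by transfers that bring two coordinates closer together, so only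
   two coefficients A = r cos t >= B = r sin t vary; condition on the sum s of the other terms.
   With g v = |s + v|^p + |s - v|^p, h = g' and q = (1 - rho) / 2, the quantity to be monotone in t is
     rho q (g A + g B) + q^2 (g (A + B) + g (A - B)).
   Its derivative is
     rho q (A h B - B h A) + q^2 ((A - B) h (A + B) - (A + B) h (A - B)),
   which vanishes at r = 0.  Differentiating once more, now along the ray r, reduces its
   nonnegativity to rho <= 2 q (that is, rho <= 1/2) and to
     2 A B (m A - m B) <= (A^2 - B^2) (m (A + B) - m (A - B))
   for m = h', which is even, and convex because p - 2 >= 1. *)
theory Submission
  imports Defs
begin

section \<open>Convexity and derivatives of powers of the absolute value\<close>

lemma convex_on_abs_powr:
  fixes r :: real
  assumes r: "r \<ge> 1"
  shows "convex_on UNIV (\<lambda>x::real. \<bar>x\<bar> powr r)"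
proof (rule convex_onI)
  fix t x y :: real
  assume t: "0 < t" "t < 1"
  \<comment> \<open>Serves the case where an endpoint is 0: for 0 < c < 1 and r >= 1, c^r <=
    c.\<close>
  have small: "(c * z) powr r \<le> c * z powr r" if "0 < c" "c < 1" "0 \<le> z" for c z :: real
  proof -
    have "c powr r \<le> c powr 1" using that r by (intro powr_mono') auto
    then show ?thesis using that by (simp add: powr_mult mult_right_mono)
  qed
  have "\<bar>(1 - t) *\<^sub>R x + t *\<^sub>R y\<bar> \<le> (1 - t) * \<bar>x\<bar> + t * \<bar>y\<bar>"
    using t abs_triangle_ineq[of "(1 - t) * x" "t * y"] by (simp add: abs_mult)
  then have "\<bar>(1 - t) *\<^sub>R x + t *\<^sub>R y\<bar> powr r \<le> ((1 - t) * \<bar>x\<bar> + t * \<bar>y\<bar>) powr r"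
    using r by (intro powr_mono2) auto
  also have "\<dots> \<le> (1 - t) * \<bar>x\<bar> powr r + t * \<bar>y\<bar> powr r"
  proof (cases "x = 0 \<or> y = 0")
    case True
    then show ?thesis using t small[of t "\<bar>y\<bar>"] small[of "1 - t" "\<bar>x\<bar>"] by auto
  next
    case False
    then show ?thesis
      using convex_onD[OF powr_convex[OF r], of t "\<bar>x\<bar>" "\<bar>y\<bar>"] t by simp
  qed
  finally show "\<bar>(1 - t) *\<^sub>R x + t *\<^sub>R y\<bar> powr r \<le> (1 - t) * \<bar>x\<bar> powr r + t * \<bar>y\<bar> powr r" .
qed simp

text \<open>At 0 the difference quotient is |h|^r, which tends to 0 because r > 0; elsewhere this is
  the product rule with |x|' = sgn x. The odd power x |x|^r arises as the derivative of |x|^(r + 2),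
  up to a constant.\<close>

lemma has_real_derivative_mult_abs_powr:
  fixes r x :: real
  assumes r: "r > 0"
  shows "((\<lambda>x. x * \<bar>x\<bar> powr r) has_real_derivative (r + 1) * \<bar>x\<bar> powr r) (at x)"
proof (cases "x = 0")
  case True
  have "((\<lambda>h::real. \<bar>h\<bar> powr r) \<longlongrightarrow> \<bar>0\<bar> powr r) (at 0)"
    using r by (intro tendsto_powr' tendsto_intros) auto
  then have "((\<lambda>h::real. \<bar>h\<bar> powr r) \<longlongrightarrow> 0) (at 0)" by simp
  then have "((\<lambda>h::real. h * \<bar>h\<bar> powr r / h) \<longlongrightarrow> 0) (at 0)"
    by (rule Lim_transform_eventually) (simp add: eventually_at_filter)
  then show ?thesis using True r by (simp add: DERIV_def)
next
  case False
  have "(abs has_real_derivative sgn x) (at x)"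
    using has_derivative_norm[OF False]
    by (simp add: has_field_derivative_def real_norm_def[abs_def] mult.commute[of _ "sgn x"])
  then have "((\<lambda>x. \<bar>x\<bar> powr r) has_real_derivative r * \<bar>x\<bar> powr (r - 1) * sgn x) (at x)"
    using False by (auto intro!: derivative_eq_intros)
  from DERIV_mult[OF DERIV_ident this]
  have "((\<lambda>x. x * \<bar>x\<bar> powr r) has_real_derivative \<bar>x\<bar> powr r + x * (r * \<bar>x\<bar> powr (r - 1) * sgn x)) (at x)"
    by (simp add: mult_ac)
  also have "x * (r * \<bar>x\<bar> powr (r - 1) * sgn x) = r * (\<bar>x\<bar> * \<bar>x\<bar> powr (r - 1))"
    by (simp add: abs_sgn mult_ac)
  also have "\<bar>x\<bar> * \<bar>x\<bar> powr (r - 1) = \<bar>x\<bar> powr r"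
    using False by (simp add: powr_diff)
  finally show ?thesis by (simp add: algebra_simps)
qed

lemma has_real_derivative_abs_powr:
  fixes p x :: real
  assumes p: "p > 2"
  shows "((\<lambda>x. \<bar>x\<bar> powr p) has_real_derivative p * (x * \<bar>x\<bar> powr (p - 2))) (at x)"
proof -
  \<comment> \<open>This factorisation reduces the claim to the previous derivative and spares a
    second treatment of the point 0.\<close>
  have eq: "\<bar>x\<bar> powr p = x * (x * \<bar>x\<bar> powr (p - 2))" for x :: real
  proof (cases "x = 0")
    case False
    then show ?thesis by (simp add: powr_diff field_simps power2_eq_square)
  qed (use p in simp)
  have "((\<lambda>x. x * \<bar>x\<bar> powr (p - 2)) has_real_derivative (p - 2 + 1) * \<bar>x\<bar> powr (p - 2)) (at x)"
    using p by (intro has_real_derivative_mult_abs_powr) simp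
  from DERIV_mult[OF DERIV_ident this] show ?thesis
    unfolding eq by (simp add: algebra_simps)
qed

section \<open>Even convex functions on the line\<close>

text \<open>The point x lies between -y and y, where m takes the same value.\<close>

lemma even_convex_mono:
  fixes m :: "real \<Rightarrow> real"
  assumes cv: "convex_on UNIV m" and even: "\<And>x. m (- x) = m x"
    and xy: "0 \<le> x" "x \<le> y"
  shows "m x \<le> m y"
proof (cases "y = 0")
  case False
  define t where "t = (x + y) / (2 * y)"
  have t: "0 \<le> t" "t \<le> 1" using xy False by (auto simp: t_def field_simps)
  have "(1 - t) * (- y) + t * y = x" using False by (simp add: t_def field_simps)
  then have "m x \<le> (1 - t) * m (- y) + t * m y"
    using convex_onD[OF cv t, of "- y" y] by simp
  then show ?thesis by (simp add: even algebra_simps)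
qed (use xy in auto)

text \<open>Each case compares m A - m B with m (A + B) - m (A - B) through chords of m. If 2 B <=
  A, then B <= A - B <= A, and two chords are chained: over [B, A] and over [A - B, A + B].
  Otherwise A - B < B, and the chord over [B, A + B] suffices, since m (A - B) <= m B.\<close>

lemma even_convex_increment:
  fixes m :: "real \<Rightarrow> real"
  assumes cv: "convex_on UNIV m" and even: "\<And>x. m (- x) = m x"
    and AB: "0 \<le> B" "B \<le> A"
  shows "2 * (A * B) * (m A - m B) \<le> (A\<^sup>2 - B\<^sup>2) * (m (A + B) - m (A - B))"
proof (cases "B = 0 \<or> A = B")
  case True
  then show ?thesis by auto
next
  case False
  with AB have pos: "0 < B" "B < A" by auto
  have mAB: "m B \<le> m A" using even_convex_mono[OF cv even] AB by auto
  show ?thesis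
  proof (cases "2 * B \<le> A")
    case True
    have "m A \<le> (1 - 1/2) * m (A - B) + 1/2 * m (A + B)"
      using convex_onD[OF cv, of "1/2" "A - B" "A + B"] by (simp add: field_simps)
    then have 1: "2 * (m A - m (A - B)) \<le> m (A + B) - m (A - B)" by simp
    \<comment> \<open>The weight that places A - B on the segment from A to B; t <= 1 is exactly 2 B
      <= A.\<close>
    define t where "t = B / (A - B)"
    have t: "0 \<le> t" "t \<le> 1" using True pos by (auto simp: t_def field_simps)
    have "(1 - t) * A + t * B = A - t * (A - B)" by (simp add: algebra_simps)
    also have "\<dots> = A - B" using pos by (simp add: t_def)
    finally have "m (A - B) \<le> (1 - t) * m A + t * m B"
      using convex_onD[OF cv t, of A B] by simp
    then have "t * (m A - m B) \<le> m A - m (A - B)" by (simp add: algebra_simps)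
    then have "2 * (t * (m A - m B)) \<le> m (A + B) - m (A - B)" using 1 by simp
    then have "(A\<^sup>2 - B\<^sup>2) * (2 * (t * (m A - m B))) \<le> (A\<^sup>2 - B\<^sup>2) * (m (A + B) - m (A - B))"
      using pos by (intro mult_left_mono) auto
    moreover have "(A\<^sup>2 - B\<^sup>2) * (2 * (t * (m A - m B))) = 2 * ((A + B) * B) * (m A - m B)"
    proof -
      have "(A\<^sup>2 - B\<^sup>2) * t = (A + B) * B"
        using pos by (simp add: t_def field_simps power2_eq_square)
      then show ?thesis by (metis mult.assoc mult.left_commute)
    qed
    moreover have "2 * (A * B) * (m A - m B) \<le> 2 * ((A + B) * B) * (m A - m B)"
      using pos mAB by (intro mult_right_mono mult_left_mono) auto
    ultimately show ?thesis by linarith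
  next
    case False
    \<comment> \<open>The weight that places A on the segment from B to A + B.\<close>
    define t where "t = (A - B) / A"
    have t: "0 \<le> t" "t \<le> 1" using pos by (auto simp: t_def field_simps)
    have "(1 - t) * B + t * (A + B) = B + t * A" by (simp add: algebra_simps)
    also have "\<dots> = A" using pos by (simp add: t_def)
    finally have "m A \<le> (1 - t) * m B + t * m (A + B)"
      using convex_onD[OF cv t, of B "A + B"] by simp
    then have "m A - m B \<le> t * (m (A + B) - m B)" by (simp add: algebra_simps)
    moreover have "t * (m (A + B) - m B) \<le> t * (m (A + B) - m (A - B))"
      using even_convex_mono[OF cv even, of "A - B" B] False pos t
      by (intro mult_left_mono) auto
    ultimately have "m A - m B \<le> t * (m (A + B) - m (A - B))" by linarith
    then have "A * (m A - m B) \<le> A * (t * (m (A + B) - m (A - B)))"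
      using pos by (intro mult_left_mono) auto
    then have 1: "A * (m A - m B) \<le> (A - B) * (m (A + B) - m (A - B))"
      using pos by (simp add: t_def)
    have "2 * (A * B) * (m A - m B) = (2 * B) * (A * (m A - m B))" by simp
    also have "\<dots> \<le> (A + B) * (A * (m A - m B))"
      using pos mAB by (intro mult_right_mono) auto
    also have "\<dots> \<le> (A + B) * ((A - B) * (m (A + B) - m (A - B)))"
      using pos 1 by (intro mult_left_mono) auto
    also have "\<dots> = (A\<^sup>2 - B\<^sup>2) * (m (A + B) - m (A - B))"
      by (simp add: algebra_simps power2_eq_square)
    finally show ?thesis .
  qed
qed

section \<open>Rotating a pair of coefficients along a circle\<close>

text \<open>Scale only the arguments of h by u and keep the outer factors. The resulting
  \<open>E\<close> vanishes at 0 and equals the claimed expression at 1. Its derivative is \<alpha>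
  A B (m (u B) - m (u A)) + \<beta> (A^2 - B^2) (m (u (A + B)) - m (u (A - B))), which is
  nonnegative by \<open>even_convex_increment\<close> and \<alpha> <= 2 \<beta>.\<close>

lemma rotation_derivative_nonneg:
  fixes h m :: "real \<Rightarrow> real"
  assumes cv: "convex_on UNIV m" and even: "\<And>x. m (- x) = m x"
    and h: "\<And>x. (h has_real_derivative m x) (at x)" and h0: "h 0 = 0"
    and AB: "0 \<le> B" "B \<le> A" and \<alpha>\<beta>: "0 \<le> \<beta>" "\<alpha> \<le> 2 * \<beta>"
  shows "0 \<le> \<alpha> * (A * h B - B * h A) + \<beta> * ((A - B) * h (A + B) - (A + B) * h (A - B))"
proof -
  define E where "E u = \<alpha> * (A * h (u * B) - B * h (u * A))
      + \<beta> * ((A - B) * h (u * (A + B)) - (A + B) * h (u * (A - B)))" for u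
  define E' where "E' u = \<alpha> * (A * (m (u * B) * B) - B * (m (u * A) * A))
      + \<beta> * ((A - B) * (m (u * (A + B)) * (A + B)) - (A + B) * (m (u * (A - B)) * (A - B)))" for u
  have hc: "((\<lambda>u. h (u * c)) has_real_derivative m (u * c) * c) (at u)" for c u
    by (rule DERIV_chain2[OF h]) (auto intro!: derivative_eq_intros)
  have "E 0 \<le> E 1"
  proof (rule DERIV_nonneg_imp_nondecreasing[of 0 1 E])
    fix u :: real
    assume u: "0 \<le> u" "u \<le> 1"
    have "(E has_real_derivative E' u) (at u)"
      unfolding E_def E'_def by (intro derivative_intros DERIV_cmult hc)
    moreover have "0 \<le> E' u"
    proof (cases "u = 0")
      case True
      then show ?thesis by (simp add: E'_def algebra_simps)
    next
      case False
      \<comment> \<open>The increment inequality at u A and u B carries a factor u^2 on both sides;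
        cancelling it is why u = 0 is treated apart.\<close>
      have "u\<^sup>2 * (2 * (A * B) * (m (u * A) - m (u * B)))
        \<le> u\<^sup>2 * ((A\<^sup>2 - B\<^sup>2) * (m (u * (A + B)) - m (u * (A - B))))"
        using even_convex_increment[OF cv even, of "u * B" "u * A"] u AB
          mult_left_mono[of B A u]
        by (simp add: algebra_simps power2_eq_square)
      then have "2 * (A * B) * (m (u * A) - m (u * B))
        \<le> (A\<^sup>2 - B\<^sup>2) * (m (u * (A + B)) - m (u * (A - B)))"
        using False by (subst (asm) mult_le_cancel_left_pos) auto
      then have "\<beta> * (2 * (A * B) * (m (u * A) - m (u * B)))
        \<le> \<beta> * ((A\<^sup>2 - B\<^sup>2) * (m (u * (A + B)) - m (u * (A - B))))"
        using \<alpha>\<beta> by (intro mult_left_mono)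
      moreover have "m (u * B) \<le> m (u * A)"
        using u AB by (intro even_convex_mono[OF cv even]) (auto intro: mult_left_mono)
      then have "\<alpha> * (A * B * (m (u * A) - m (u * B))) \<le> 2 * \<beta> * (A * B * (m (u * A) - m (u * B)))"
        using \<alpha>\<beta> AB by (intro mult_right_mono) auto
      ultimately show ?thesis by (simp add: E'_def algebra_simps power2_eq_square)
    qed
    ultimately show "\<exists>y. (E has_real_derivative y) (at u) \<and> 0 \<le> y" by blast
  qed simp
  then show ?thesis by (simp add: E_def h0)
qed

text \<open>Both pairs lie on one circle of radius r, at angles in [0, pi/4]. Since A^2 - B^2 = r^2
  cos (2 t), the hypothesis on differences says that the unprimed pair has the larger angle. Along
  the arc, the derivative is the expression of \<open>rotation_derivative_nonneg\<close>.\<close>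

lemma rotation_mono:
  fixes g h m :: "real \<Rightarrow> real"
  assumes cv: "convex_on UNIV m" and even: "\<And>x. m (- x) = m x"
    and h: "\<And>x. (h has_real_derivative m x) (at x)" and h0: "h 0 = 0"
    and g: "\<And>x. (g has_real_derivative h x) (at x)"
    and \<alpha>\<beta>: "0 \<le> \<beta>" "\<alpha> \<le> 2 * \<beta>"
    and AB: "0 \<le> B'" "B \<le> A" "0 \<le> B" "B' \<le> A'"
    and sum: "A\<^sup>2 + B\<^sup>2 = A'\<^sup>2 + B'\<^sup>2" and diff: "A\<^sup>2 - B\<^sup>2 \<le> A'\<^sup>2 - B'\<^sup>2"
  shows "\<alpha> * (g A' + g B') + \<beta> * (g (A' + B') + g (A' - B'))
    \<le> \<alpha> * (g A + g B) + \<beta> * (g (A + B) + g (A - B))"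
proof (cases "A\<^sup>2 + B\<^sup>2 = 0")
  case True
  then show ?thesis using sum by (auto simp: sum_power2_eq_zero_iff)
next
  case False
  define r where "r = sqrt (A\<^sup>2 + B\<^sup>2)"
  have r: "0 < r" using False by (simp add: r_def sum_power2_gt_zero_iff)
  have r2: "r\<^sup>2 = A\<^sup>2 + B\<^sup>2" "r\<^sup>2 = A'\<^sup>2 + B'\<^sup>2" by (simp_all add: r_def sum)
  have polar: "\<exists>t. 0 \<le> t \<and> t \<le> pi / 4 \<and> x = r * cos t \<and> y = r * sin t"
    if xy: "0 \<le> y" "y \<le> x" "r\<^sup>2 = x\<^sup>2 + y\<^sup>2" for x y
  proof -
    have "(x / r)\<^sup>2 + (y / r)\<^sup>2 = 1"
      using xy(3) r by (metis add_divide_distrib div_self less_irrefl power_divide power_eq_0_iff)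
    then obtain t where t: "0 \<le> t" "t \<le> pi / 2" "x / r = cos t" "y / r = sin t"
      using sincos_total_pi_half[of "x / r" "y / r"] xy r by auto
    have "sin t \<le> cos t" using xy r t(3,4)[symmetric] by (simp add: divide_right_mono)
    then have "(sin t)\<^sup>2 \<le> (cos t)\<^sup>2"
      using t sin_ge_zero[of t] by (intro power_mono) auto
    \<comment> \<open>The condition y <= x becomes cos (2 t) >= 0, and cosine is decreasing on
      [0, pi], which contains 2 t.\<close>
    then have "cos (pi / 2) \<le> cos (2 * t)" by (simp add: cos_double)
    then have "2 * t \<le> pi / 2"
      using t by (subst (asm) cos_mono_le_eq) auto
    then show ?thesis using t r by (intro exI[of _ t]) (auto simp: field_simps)
  qed
  obtain t where t: "0 \<le> t" "t \<le> pi / 4" "A = r * cos t" "B = r * sin t"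
    using polar[of B A] AB r2 by auto
  obtain t' where t': "0 \<le> t'" "t' \<le> pi / 4" "A' = r * cos t'" "B' = r * sin t'"
    using polar[of B' A'] AB r2 by auto
  have "r\<^sup>2 * cos (2 * t) \<le> r\<^sup>2 * cos (2 * t')"
    using diff unfolding t t' cos_double by (simp add: power_mult_distrib algebra_simps)
  then have "cos (2 * t) \<le> cos (2 * t')" using r by simp
  then have "2 * t' \<le> 2 * t" using t t' by (subst (asm) cos_mono_le_eq) auto
  then have tt: "t' \<le> t" by simp
  define F where "F t = \<alpha> * (g (r * cos t) + g (r * sin t))
    + \<beta> * (g (r * cos t + r * sin t) + g (r * cos t - r * sin t))" for t
  have "F t' \<le> F t"
  proof (rule DERIV_nonneg_imp_nondecreasing[OF tt, of F])
    fix u assume u: "t' \<le> u" "u \<le> t"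
    define c s where "c = r * cos u" and "s = r * sin u"
    have u': "0 \<le> u" "u \<le> pi / 4" using u t t' by auto
    have "0 \<le> s" using u' r sin_ge_zero[of u] by (simp add: s_def)
    moreover have "s \<le> c"
    proof -
      have "sin u \<le> sin (pi / 4)" using u' by (intro sin_monotone_2pi_le) auto
      also have "\<dots> = cos (pi / 4)" by (simp add: sin_45 cos_45)
      also have "\<dots> \<le> cos u" using u' by (intro cos_monotone_0_pi_le) auto
      finally show ?thesis using r by (simp add: c_def s_def)
    qed
    ultimately have "0 \<le> \<alpha> * (c * h s - s * h c) + \<beta> * ((c - s) * h (c + s) - (c + s) * h (c - s))"
      by (intro rotation_derivative_nonneg[OF cv even h h0 _ _ \<alpha>\<beta>])
    moreover have "(F has_real_derivative
      (\<alpha> * (c * h s - s * h c) + \<beta> * ((c - s) * h (c + s) - (c + s) * h (c - s)))) (at u)"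
      unfolding F_def c_def s_def
      by (auto intro!: derivative_eq_intros DERIV_chain2[OF g] simp: algebra_simps)
    ultimately show "\<exists>y. (F has_real_derivative y) (at u) \<and> 0 \<le> y" by blast
  qed
  then show ?thesis by (simp add: F_def t t')
qed

section \<open>Averages over independent three-valued variables\<close>

text \<open>This is the expectation of f (s + sum of a_i X_i), computed by conditioning on one
  variable at a time; s collects the terms already fixed. It frees the inequalities from the
  probability space.\<close>

fun ternary_mean :: "real \<Rightarrow> (real \<Rightarrow> real) \<Rightarrow> real list \<Rightarrow> real \<Rightarrow> real" where
  "ternary_mean \<rho> f [] s = f s"
| "ternary_mean \<rho> f (a # as) s = \<rho> * ternary_mean \<rho> f as s
     + (1 - \<rho>) / 2 * (ternary_mean \<rho> f as (s + a) + ternary_mean \<rho> f as (s - a))"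

text \<open>The averaging operators of two coefficients commute, because translations do.\<close>

lemma ternary_mean_move:
  "ternary_mean \<rho> f (us @ a # vs) s = ternary_mean \<rho> f (a # us @ vs) s"
proof (induction us arbitrary: s)
  case (Cons u us)
  have *: "s + u - a = s - a + u" "s + u + a = s + a + u" "s - u + a = s + a - u" "s - u - a = s - a - u"
    by simp_all
  show ?case by (simp add: Cons.IH *) (simp add: field_simps)
qed simp

lemma ternary_mean_cong_mset:
  assumes "mset as = mset bs"
  shows "ternary_mean \<rho> f as s = ternary_mean \<rho> f bs s"
  using assms
proof (induction as arbitrary: bs s)
  case (Cons a as)
  then have "a \<in> set bs" by (metis list.set_intros(1) set_mset_mset)
  then obtain us vs where bs: "bs = us @ a # vs" by (meson split_list)
  with Cons.prems have "mset as = mset (us @ vs)" by simp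
  then show ?case unfolding bs ternary_mean_move by (simp add: Cons.IH[of "us @ vs"])
qed simp

text \<open>This is the conditioning on all other terms: an inequality valid at every shift survives
  averaging with nonnegative weights, so only the tail of the list has to be compared.\<close>

lemma ternary_mean_append_mono:
  assumes "0 \<le> \<rho>" "\<rho> \<le> 1"
    and "\<And>s. ternary_mean \<rho> f bs s \<le> ternary_mean \<rho> f bs' s"
  shows "ternary_mean \<rho> f (as @ bs) s \<le> ternary_mean \<rho> f (as @ bs') s"
  using assms by (induction as arbitrary: s) (auto intro!: add_mono mult_left_mono)

lemma ternary_mean_nonneg:
  assumes "0 \<le> \<rho>" "\<rho> \<le> 1" "\<And>s. 0 \<le> f s"
  shows "0 \<le> ternary_mean \<rho> f as s"
  using assms by (induction as arbitrary: s) auto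

section \<open>The moment as a ternary average\<close>

context prob_space
begin

text \<open>Induction on n, conditioning on the last variable \<open>X n\<close>; hence the reversed
  list, whose head is the last coefficient. The shift s is general because the three outcomes of
  \<open>X n\<close> move it.\<close>

lemma expectation_ternary_sum:
  fixes X :: "nat \<Rightarrow> 'a \<Rightarrow> real"
  assumes ind: "indep_vars (\<lambda>_. borel) X UNIV"
    and p0: "\<And>i. prob {\<omega> \<in> space M. X i \<omega> = 0} = \<rho>"
    and p1: "\<And>i. prob {\<omega> \<in> space M. X i \<omega> = 1} = (1 - \<rho>) / 2"
    and pm1: "\<And>i. prob {\<omega> \<in> space M. X i \<omega> = -1} = (1 - \<rho>) / 2"
    and f: "continuous_on UNIV f"
  shows "expectation (\<lambda>\<omega>. f (s + (\<Sum>i<n. a i * X i \<omega>))) = ternary_mean \<rho> f (map a (rev [0..<n])) s"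
proof (induction n arbitrary: s)
  case 0
  then show ?case by (simp add: prob_space)
next
  case (Suc n)
  define S where "S = (\<lambda>\<omega>. \<Sum>i<n. a i * X i \<omega>)"
  have X[measurable]: "random_variable borel (X i)" for i
    using ind by (auto simp: indep_vars_def)
  have f_meas[measurable]: "f \<in> borel_measurable borel"
    using f by (rule borel_measurable_continuous_onI)
  have S_meas[measurable]: "random_variable borel S" unfolding S_def by measurable
  have AE_X: "AE \<omega> in M. X i \<omega> \<in> {0, 1, -1}" for i
  proof -
    have "prob ({\<omega> \<in> space M. X i \<omega> = 0} \<union> ({\<omega> \<in> space M. X i \<omega> = 1} \<union> {\<omega> \<in> space M. X i \<omega> = -1})) = 1"
      by (subst finite_measure_Union; (subst finite_measure_Union)?) (auto simp: p0 p1 pm1)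
    then have "AE \<omega> in M. \<omega> \<in> {\<omega> \<in> space M. X i \<omega> = 0}
      \<union> ({\<omega> \<in> space M. X i \<omega> = 1} \<union> {\<omega> \<in> space M. X i \<omega> = -1})"
      by (subst (asm) prob_eq_1) auto
    then show ?thesis by eventually_elim auto
  qed
  have S_bdd: "AE \<omega> in M. \<bar>S \<omega>\<bar> \<le> (\<Sum>i<n. \<bar>a i\<bar>)"
  proof -
    have "AE \<omega> in M. \<forall>i. X i \<omega> \<in> {0, 1, -1}" using AE_X by (simp add: AE_all_countable)
    then show ?thesis
    proof eventually_elim
      case (elim \<omega>)
      then have "\<bar>a i * X i \<omega>\<bar> \<le> \<bar>a i\<bar>" for i
        using elim by (auto simp: abs_mult dest!: spec[of _ i])
      then show ?case unfolding S_def by (intro order_trans[OF sum_abs] sum_mono)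
    qed
  qed
  \<comment> \<open>\<open>S\<close> is almost surely confined to a compact interval, so continuity
    of f alone gives a bounded integrand.\<close>
  have int: "integrable M (\<lambda>\<omega>. f (c + S \<omega>))" for c
  proof -
    define C where "C = (\<Sum>i<n. \<bar>a i\<bar>)"
    have "compact ((\<lambda>y. f (c + y)) ` {-C..C})"
      by (intro compact_continuous_image continuous_on_compose2[OF f] continuous_intros) auto
    then obtain K where K: "\<And>y. y \<in> {-C..C} \<Longrightarrow> norm (f (c + y)) \<le> K"
      by (meson bounded_iff compact_imp_bounded image_eqI)
    show ?thesis
    proof (rule integrable_const_bound[where B = K])
      show "AE \<omega> in M. norm (f (c + S \<omega>)) \<le> K"
        using S_bdd by eventually_elim (intro K, auto simp: C_def abs_le_iff)
    qed measurable
  qed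
  have indS: "indep_var borel (X n) borel S"
  proof -
    \<comment> \<open>Coefficient 1 at index n makes that term \<open>X n\<close> itself, so the
      library result on a term and the sum of the others applies directly.\<close>
    have "indep_vars (\<lambda>_. borel) (\<lambda>i \<omega>. (if i = n then 1 else a i) * X i \<omega>) (insert n {..<n})"
      by (rule indep_vars_subset[OF indep_vars_compose2[OF ind]]) auto
    from indep_vars_sum[OF _ _ this]
    have "indep_var borel (X n) borel (\<lambda>\<omega>. \<Sum>i<n. (if i = n then 1 else a i) * X i \<omega>)" by simp
    also have "(\<lambda>\<omega>. \<Sum>i<n. (if i = n then 1 else a i) * X i \<omega>) = S"
      by (auto simp: S_def fun_eq_iff intro!: sum.cong)
    finally show ?thesis .
  qed
  have prod: "expectation (\<lambda>\<omega>. indicator {x} (X n \<omega>) * f (c + S \<omega>))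
      = prob {\<omega> \<in> space M. X n \<omega> = x} * expectation (\<lambda>\<omega>. f (c + S \<omega>))"
    and int_prod: "integrable M (\<lambda>\<omega>. indicator {x} (X n \<omega>) * f (c + S \<omega>))" for x c :: real
  proof -
    have iv: "indep_var borel (indicator {x} \<circ> X n :: 'a \<Rightarrow> real) borel ((\<lambda>y. f (c + y)) \<circ> S)"
      by (rule indep_var_compose[OF indS]) measurable
    have int_ind: "integrable M (\<lambda>\<omega>. indicator {x} (X n \<omega>) :: real)"
      by (rule integrable_const_bound[where B = 1]) (auto simp: indicator_def)
    have "expectation (\<lambda>\<omega>. indicator {x} (X n \<omega>) :: real)
        = expectation (indicator {\<omega> \<in> space M. X n \<omega> = x})"
      by (intro Bochner_Integration.integral_cong) (auto simp: indicator_def)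
    also have "\<dots> = prob {\<omega> \<in> space M. X n \<omega> = x}" by simp
    finally show "expectation (\<lambda>\<omega>. indicator {x} (X n \<omega>) * f (c + S \<omega>))
      = prob {\<omega> \<in> space M. X n \<omega> = x} * expectation (\<lambda>\<omega>. f (c + S \<omega>))"
      using indep_var_lebesgue_integral[OF iv] int int_ind by (simp add: comp_def)
    show "integrable M (\<lambda>\<omega>. indicator {x} (X n \<omega>) * f (c + S \<omega>))"
      using indep_var_integrable[OF iv] int int_ind by (simp add: comp_def)
  qed
  let ?I = "\<lambda>x c \<omega>. indicator {x} (X n \<omega>) * f (c + S \<omega>)"
  have "expectation (\<lambda>\<omega>. f (s + (\<Sum>i<Suc n. a i * X i \<omega>)))
      = expectation (\<lambda>\<omega>. ?I 0 s \<omega> + (?I 1 (s + a n) \<omega> + ?I (-1) (s - a n) \<omega>))"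
  \<comment> \<open>Almost surely exactly one of the three indicators is 1, and it fixes the shift
    contributed by \<open>X n\<close>.\<close>
  proof (rule integral_cong_AE)
    show "AE \<omega> in M. f (s + (\<Sum>i<Suc n. a i * X i \<omega>))
        = ?I 0 s \<omega> + (?I 1 (s + a n) \<omega> + ?I (-1) (s - a n) \<omega>)"
      using AE_X[of n] by eventually_elim (auto simp: S_def algebra_simps)
  qed measurable
  also have "\<dots> = expectation (?I 0 s) + (expectation (?I 1 (s + a n)) + expectation (?I (-1) (s - a n)))"
    by (simp only: Bochner_Integration.integral_add int_prod Bochner_Integration.integrable_add)
  also have "\<dots> = ternary_mean \<rho> f (map a (rev [0..<Suc n])) s"
    unfolding prod p0 p1 pm1 unfolding S_def Suc.IH by (simp add: algebra_simps)
  finally show ?case .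
qed

end

section \<open>Majorisation through transfers between two coordinates\<close>

text \<open>Brings the two coordinates of a transfer to the end of the list, where
  \<open>ternary_mean_append_mono\<close> isolates them.\<close>

lemma mset_map_two_points:
  assumes "l < n" "k < n" "l \<noteq> k"
  shows "mset (map y (rev [0..<n]))
    = mset (map y (filter (\<lambda>i. i \<noteq> l \<and> i \<noteq> k) [0..<n]) @ [y l, y k])"
proof -
  have "{#i \<in># mset_set {0..<n}. \<not> (i \<noteq> l \<and> i \<noteq> k)#} = mset_set {i \<in> {0..<n}. \<not> (i \<noteq> l \<and> i \<noteq> k)}"
    by (rule filter_mset_mset_set) simp
  also have "{i \<in> {0..<n}. \<not> (i \<noteq> l \<and> i \<noteq> k)} = {l, k}" using assms by auto
  finally have "{#i \<in># mset [0..<n]. \<not> (i \<noteq> l \<and> i \<noteq> k)#} = {#l, k#}"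
    using assms(3) by (simp add: mset_upt)
  then have "mset [0..<n] = {#i \<in># mset [0..<n]. i \<noteq> l \<and> i \<noteq> k#} + {#l, k#}"
    by (metis multiset_partition)
  then have "image_mset y (mset [0..<n]) = image_mset y {#i \<in># mset [0..<n]. i \<noteq> l \<and> i \<noteq> k#} + {#y l, y k#}"
    by (metis (no_types, lifting) image_mset_add_mset image_mset_empty image_mset_union)
  then show ?thesis by (simp add: rev_map[symmetric])
qed

lemma sum_split_at:
  fixes z :: "nat \<Rightarrow> real"
  assumes "k < n"
  shows "(\<Sum>i<n. z i) = (\<Sum>i<k. z i) + (z k + (\<Sum>i\<in>{Suc k..<n}. z i))"
proof -
  have "(\<Sum>i<n. z i) = (\<Sum>i<k. z i) + (\<Sum>i\<in>{k..<n}. z i)"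
    using sum.atLeastLessThan_concat[of 0 k n z] assms by (simp add: lessThan_atLeast0)
  then show ?thesis using assms by (simp add: sum.atLeast_Suc_lessThan)
qed

text \<open>Induction on the number of indices where x and y differ. Each step moves an amount from
  a coordinate k with surplus to a later coordinate l with deficit, makes at least one of them agree
  with x, and keeps the partial-sum inequalities.\<close>

lemma majorisation_by_transfers:
  fixes \<Phi> :: "(nat \<Rightarrow> real) \<Rightarrow> real" and x y :: "nat \<Rightarrow> real"
  assumes transfer: "\<And>y k l \<delta>. k < n \<Longrightarrow> l < n \<Longrightarrow> k \<noteq> l \<Longrightarrow> (\<And>i. i < n \<Longrightarrow> 0 \<le> y i) \<Longrightarrow> 0 \<le> \<delta> \<Longrightarrow>
      y l + \<delta> \<le> y k - \<delta> \<Longrightarrow> \<Phi> y \<le> \<Phi> (y(k := y k - \<delta>, l := y l + \<delta>))"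
    and ext: "\<And>y y'. (\<And>i. i < n \<Longrightarrow> y i = y' i) \<Longrightarrow> \<Phi> y = \<Phi> y'"
    and nonneg: "\<And>i. i < n \<Longrightarrow> 0 \<le> x i" "\<And>i. i < n \<Longrightarrow> 0 \<le> y i"
    and sorted: "\<And>i j. i \<le> j \<Longrightarrow> j < n \<Longrightarrow> x j \<le> x i"
    and sum: "(\<Sum>i<n. x i) = (\<Sum>i<n. y i)"
    and le: "\<And>k. k \<le> n \<Longrightarrow> (\<Sum>i<k. x i) \<le> (\<Sum>i<k. y i)"
  shows "\<Phi> y \<le> \<Phi> x"
  using nonneg(2) sum le
proof (induction "card {i. i < n \<and> x i \<noteq> y i}" arbitrary: y rule: less_induct)
  case less
  show ?case
  proof (cases "\<exists>i<n. x i < y i")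
    case False
    then have "\<And>i. i \<in> {..<n} \<Longrightarrow> y i \<le> x i" by auto
    then have "y i = x i" if "i < n" for i
      using sum_mono_inv[OF less.prems(2)[symmetric], of i] that by simp
    then show ?thesis using ext[of y x] by simp
  next
    case True
    \<comment> \<open>Between the last index k with \<open>x k < y k\<close> and the next l with \<open>y l < x l\<close> the entries agree,
      so the partial sums there have slack at least \<open>y k - x k\<close>. Hence y need not be, or stay, sorted.\<close>
    define k where "k = Max {i. i < n \<and> x i < y i}"
    have k: "k < n" "x k < y k"
      using Max_in[of "{i. i < n \<and> x i < y i}"] True by (auto simp: k_def)
    have kmax: "y i \<le> x i" if "k < i" "i < n" for i
    proof (rule ccontr)
      assume "\<not> y i \<le> x i"
      then have "i \<le> k" unfolding k_def using that by (intro Max_ge) auto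
      then show False using that by simp
    qed
    \<comment> \<open>Otherwise x and y agree beyond k, and the surplus at k together with the
      partial sums up to k contradicts the equal totals.\<close>
    have "\<exists>l. k < l \<and> l < n \<and> y l < x l"
    proof (rule ccontr)
      assume no: "\<nexists>l. k < l \<and> l < n \<and> y l < x l"
      have split: "(\<Sum>i<n. z i) = (\<Sum>i<k. z i) + (z k + (\<Sum>i\<in>{Suc k..<n}. z i))" for z :: "nat \<Rightarrow> real"
        using k by (intro sum_split_at) auto
      have "(\<Sum>i\<in>{Suc k..<n}. x i) = (\<Sum>i\<in>{Suc k..<n}. y i)"
      proof (rule sum.cong)
        fix i assume i: "i \<in> {Suc k..<n}"
        then have "\<not> y i < x i" using no by auto
        then show "x i = y i" using kmax[of i] i by auto
      qed simp
      then show False using less.prems(2) less.prems(3)[of k] k by (simp add: split)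
    qed
    then obtain l where l: "k < l" "l < n" "y l < x l"
      and lmin: "\<And>i. i < l \<Longrightarrow> \<not> (k < i \<and> i < n \<and> y i < x i)"
      using exists_least_iff[of "\<lambda>l. k < l \<and> l < n \<and> y l < x l"] by blast
    have mid: "x i = y i" if "k < i" "i < l" for i
      using kmax[of i] lmin[of i] that l by auto
    define \<delta> where "\<delta> = min (y k - x k) (x l - y l)"
    define y' where "y' = y(k := y k - \<delta>, l := y l + \<delta>)"
    have \<delta>: "0 < \<delta>" "\<delta> \<le> y k - x k" "\<delta> \<le> x l - y l" using k l by (auto simp: \<delta>_def)
    have xkl: "x l \<le> x k" using sorted[of k l] l by simp
    \<comment> \<open>The transfer does not cross: y l + \<delta> <= x l <= x k <= y k - \<delta>,
      the middle step because x is decreasing.\<close>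
    have "\<Phi> y \<le> \<Phi> y'"
      unfolding y'_def using k l less.prems(1) \<delta> xkl by (intro transfer) auto
    also have "\<Phi> y' \<le> \<Phi> x"
    proof (rule less.hyps)
      have "x k = y' k \<or> x l = y' l" using k l by (auto simp: y'_def \<delta>_def)
      then have "k \<notin> {i. i < n \<and> x i \<noteq> y' i} \<or> l \<notin> {i. i < n \<and> x i \<noteq> y' i}" by simp
      moreover have "{k, l} \<subseteq> {i. i < n \<and> x i \<noteq> y i}" using k l by simp
      moreover have "{i. i < n \<and> x i \<noteq> y' i} \<subseteq> insert k (insert l {i. i < n \<and> x i \<noteq> y i})"
        by (auto simp: y'_def)
      ultimately have "{i. i < n \<and> x i \<noteq> y' i} \<subset> {i. i < n \<and> x i \<noteq> y i}" by blast
      then show "card {i. i < n \<and> x i \<noteq> y' i} < card {i. i < n \<and> x i \<noteq> y i}"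
        by (intro psubset_card_mono) auto
      show "0 \<le> y' i" if "i < n" for i
        using that less.prems(1)[of i] \<delta> nonneg(1)[OF k(1)] by (auto simp: y'_def)
      \<comment> \<open>Only the partial sums with k < j <= l change; they drop by \<delta>.\<close>
      have sum_y': "(\<Sum>i<j. y' i) = (\<Sum>i<j. y i) - (if k < j then \<delta> else 0) + (if l < j then \<delta> else 0)" for j
      proof -
        have "(\<Sum>i<j. y' i) = (\<Sum>i<j. y i - (if i = k then \<delta> else 0) + (if i = l then \<delta> else 0))"
          using l by (intro sum.cong) (auto simp: y'_def)
        then show ?thesis by (simp add: sum.distrib sum_subtractf)
      qed
      show "(\<Sum>i<n. x i) = (\<Sum>i<n. y' i)" using less.prems(2) k l by (simp add: sum_y')
      show "(\<Sum>i<j. x i) \<le> (\<Sum>i<j. y' i)" if "j \<le> n" for j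
      proof (cases "k < j \<and> j \<le> l")
        case False
        then show ?thesis using less.prems(3)[OF that] l by (auto simp: sum_y')
      next
        case True
        have split: "(\<Sum>i<j. z i) = (\<Sum>i<k. z i) + (z k + (\<Sum>i\<in>{Suc k..<j}. z i))" for z :: "nat \<Rightarrow> real"
          using True by (intro sum_split_at) auto
        have "(\<Sum>i\<in>{Suc k..<j}. x i) = (\<Sum>i\<in>{Suc k..<j}. y i)"
          using True by (intro sum.cong) (auto simp: mid)
        moreover have "(\<Sum>i<k. x i) \<le> (\<Sum>i<k. y i)" using less.prems(3)[of k] k by simp
        ultimately have "(\<Sum>i<j. x i) \<le> (\<Sum>i<j. y i) - \<delta>" using \<delta> by (simp add: split)
        then show ?thesis using True by (simp add: sum_y')
      qed
    qed
    finally show ?thesis .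
  qed
qed

section \<open>From a pair of coefficients to majorised vectors, for p-th powers\<close>

lemma ternary_mean_pair_mono:
  fixes p \<rho> :: real
  assumes \<rho>: "0 \<le> \<rho>" "\<rho> \<le> 1 / 2" and p: "p \<ge> 3"
    and AB: "0 \<le> B'" "B \<le> A" "0 \<le> B" "B' \<le> A'"
    and sum: "A\<^sup>2 + B\<^sup>2 = A'\<^sup>2 + B'\<^sup>2" and diff: "A\<^sup>2 - B\<^sup>2 \<le> A'\<^sup>2 - B'\<^sup>2"
  shows "ternary_mean \<rho> (\<lambda>x. \<bar>x\<bar> powr p) [A', B'] s \<le> ternary_mean \<rho> (\<lambda>x. \<bar>x\<bar> powr p) [A, B] s"
proof -
  define H where "H x = x * \<bar>x\<bar> powr (p - 2)" for x :: real
  \<comment> \<open>Writing |v - s| gives both arguments derivative 1 in v.\<close>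
  define g where "g v = \<bar>s + v\<bar> powr p + \<bar>v - s\<bar> powr p" for v
  define h where "h v = p * H (s + v) + p * H (v - s)" for v
  define m where "m v = p * ((p - 1) * \<bar>s + v\<bar> powr (p - 2)) + p * ((p - 1) * \<bar>v - s\<bar> powr (p - 2))" for v
  have H: "(H has_real_derivative (p - 1) * \<bar>x\<bar> powr (p - 2)) (at x)" for x
    using has_real_derivative_mult_abs_powr[of "p - 2" x] p by (simp add: H_def[abs_def])
  have shift: "((\<lambda>v. s + v) has_real_derivative 1) (at v)" "((\<lambda>v. v - s) has_real_derivative 1) (at v)" for v
    by (auto intro!: derivative_eq_intros)
  have h: "(h has_real_derivative m v) (at v)" for v
    unfolding h_def[abs_def] m_def
    using DERIV_chain2[OF H shift(1)] DERIV_chain2[OF H shift(2)]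
    by (intro DERIV_add DERIV_cmult) auto
  have P: "((\<lambda>x. \<bar>x\<bar> powr p) has_real_derivative p * H x) (at x)" for x
    using has_real_derivative_abs_powr[of p x] p by (simp add: H_def)
  have g: "(g has_real_derivative h v) (at v)" for v
    unfolding g_def[abs_def] h_def
    using DERIV_chain2[OF P shift(1)] DERIV_chain2[OF P shift(2)] by (intro DERIV_add) auto
  have cv: "convex_on UNIV m"
  proof (rule convex_onI)
    fix t x y :: real assume t: "0 < t" "t < 1"
    have c: "\<bar>(1 - t) * x + t * y + c\<bar> powr (p - 2)
        \<le> (1 - t) * \<bar>x + c\<bar> powr (p - 2) + t * \<bar>y + c\<bar> powr (p - 2)" for c
    proof -
      have "(1 - t) * (x + c) + t * (y + c) = (1 - t) * x + t * y + c" by (simp add: algebra_simps)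
      then show ?thesis
        using convex_onD[OF convex_on_abs_powr[of "p - 2"], of t "x + c" "y + c"] t p by simp
    qed
    have "m ((1 - t) *\<^sub>R x + t *\<^sub>R y) = p * (p - 1) *
        (\<bar>(1 - t) * x + t * y + s\<bar> powr (p - 2) + \<bar>(1 - t) * x + t * y + - s\<bar> powr (p - 2))"
      by (simp add: m_def algebra_simps)
    also have "\<dots> \<le> p * (p - 1) * (((1 - t) * \<bar>x + s\<bar> powr (p - 2) + t * \<bar>y + s\<bar> powr (p - 2))
        + ((1 - t) * \<bar>x + - s\<bar> powr (p - 2) + t * \<bar>y + - s\<bar> powr (p - 2)))"
      using p by (intro mult_left_mono add_mono c) auto
    also have "\<dots> = (1 - t) * m x + t * m y"
      by (simp add: m_def add.commute[of s]) (simp add: algebra_simps)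
    finally show "m ((1 - t) *\<^sub>R x + t *\<^sub>R y) \<le> (1 - t) * m x + t * m y" .
  qed simp
  have even: "m (- v) = m v" for v
    by (simp add: m_def abs_minus_commute[of s v] abs_minus_commute[of "- v" s] add.commute)
  have h0: "h 0 = 0" by (simp add: h_def H_def)
  define q where "q = (1 - \<rho>) / 2"
  have q: "0 \<le> q" "\<rho> \<le> 2 * q" using \<rho> by (auto simp: q_def)
  \<comment> \<open>The nine outcomes grouped by which variables are nonzero; the first term, where
    both vanish, does not depend on A and B.\<close>
  have *: "ternary_mean \<rho> (\<lambda>x. \<bar>x\<bar> powr p) [A, B] s
      = \<rho>\<^sup>2 * \<bar>s\<bar> powr p + (\<rho> * q * (g A + g B) + q\<^sup>2 * (g (A + B) + g (A - B)))" for A B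
  proof -
    have "\<bar>A + B - s\<bar> = \<bar>s - A - B\<bar>" "\<bar>A - B - s\<bar> = \<bar>s - A + B\<bar>"
      "\<bar>A - s\<bar> = \<bar>s - A\<bar>" "\<bar>B - s\<bar> = \<bar>s - B\<bar>" by linarith+
    then show ?thesis
      unfolding ternary_mean.simps g_def q_def[symmetric]
      by (simp add: algebra_simps power2_eq_square)
  qed
  \<comment> \<open>Here \<rho> <= 1/2 enters, as \<rho> <= 1 - \<rho> = 2 q; this is the condition
    \<alpha> <= 2 \<beta> for \<alpha> = \<rho> q and \<beta> = q^2.\<close>
  have "\<rho> * q \<le> 2 * q\<^sup>2" using q mult_right_mono[of \<rho> "2 * q" q] by (simp add: power2_eq_square)
  then have "\<rho> * q * (g A' + g B') + q\<^sup>2 * (g (A' + B') + g (A' - B'))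
      \<le> \<rho> * q * (g A + g B) + q\<^sup>2 * (g (A + B) + g (A - B))"
    by (intro rotation_mono[OF cv even h h0 g _ _ AB sum diff]) auto
  then show ?thesis unfolding * by simp
qed

text \<open>Turns \<open>sum_largest\<close> into plain partial sums, the form that
  \<open>majorisation_by_transfers\<close> takes.\<close>

lemma decreasing_rearrangement:
  fixes x :: "nat \<Rightarrow> real"
  obtains z where "mset (map z [0..<n]) = mset (map x [0..<n])"
    and "\<And>i j. i \<le> j \<Longrightarrow> j < n \<Longrightarrow> z j \<le> z i"
    and "\<And>k. k \<le> n \<Longrightarrow> (\<Sum>i<k. z i) = sum_largest n k x"
proof
  define L where "L = rev (sort (map x [0..<n]))"
  have len: "length L = n" by (simp add: L_def)
  have L: "map ((!) L) [0..<n] = L" using map_nth[of L] len by simp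
  show "mset (map ((!) L) [0..<n]) = mset (map x [0..<n])" unfolding L by (simp add: L_def)
  have "sorted_wrt (\<ge>) L" by (simp add: L_def sorted_wrt_rev)
  then show "L ! j \<le> L ! i" if "i \<le> j" "j < n" for i j
    using that len sorted_wrt_nth_less[of "(\<ge>)" L i j] by (cases "i = j") auto
  show "(\<Sum>i<k. L ! i) = sum_largest n k x" if "k \<le> n" for k
    using that len
    by (simp add: sum_largest_def L_def[symmetric] sum_list_sum_nth lessThan_atLeast0 min_absorb2 min_absorb1)
qed

text \<open>The average is invariant under permutations, so x and y may be replaced by their
  decreasing rearrangements and joined by transfers.\<close>

lemma ternary_mean_majorised:
  fixes p \<rho> :: real and x y :: "nat \<Rightarrow> real"
  assumes \<rho>: "0 \<le> \<rho>" "\<rho> \<le> 1 / 2" and p: "p \<ge> 3"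
    and nonneg: "\<And>i. i < n \<Longrightarrow> 0 \<le> x i" "\<And>i. i < n \<Longrightarrow> 0 \<le> y i"
    and maj: "majorised_by n x y"
  shows "ternary_mean \<rho> (\<lambda>x. \<bar>x\<bar> powr p) (map (\<lambda>i. sqrt (y i)) (rev [0..<n])) s
    \<le> ternary_mean \<rho> (\<lambda>x. \<bar>x\<bar> powr p) (map (\<lambda>i. sqrt (x i)) (rev [0..<n])) s"
proof -
  define \<Phi> where "\<Phi> a = ternary_mean \<rho> (\<lambda>x. \<bar>x\<bar> powr p) (map (\<lambda>i. sqrt (a i)) (rev [0..<n])) s"
    for a :: "nat \<Rightarrow> real"
  have perm: "\<Phi> a = \<Phi> b" if "mset (map a [0..<n]) = mset (map b [0..<n])" for a b :: "nat \<Rightarrow> real"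
  proof -
    have "mset (map sqrt (map a [0..<n])) = mset (map sqrt (map b [0..<n]))"
      using that by (metis mset_map)
    then show ?thesis unfolding \<Phi>_def
      by (intro ternary_mean_cong_mset) (simp add: rev_map[symmetric] comp_def)
  qed
  have transfer: "\<Phi> y \<le> \<Phi> (y(k := y k - \<delta>, l := y l + \<delta>))"
    if kl: "k < n" "l < n" "k \<noteq> l" and y: "\<And>i. i < n \<Longrightarrow> 0 \<le> y i"
      and \<delta>: "0 \<le> \<delta>" "y l + \<delta> \<le> y k - \<delta>" for y :: "nat \<Rightarrow> real" and k l \<delta>
  proof -
    define y' where "y' = y(k := y k - \<delta>, l := y l + \<delta>)"
    define as where "as z = map (\<lambda>i. sqrt (z i)) (filter (\<lambda>i. i \<noteq> k \<and> i \<noteq> l) [0..<n])"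
      for z :: "nat \<Rightarrow> real"
    have \<Phi>: "\<Phi> z = ternary_mean \<rho> (\<lambda>x. \<bar>x\<bar> powr p) (as z @ [sqrt (z k), sqrt (z l)]) s"
      for z unfolding \<Phi>_def as_def
      by (rule ternary_mean_cong_mset[OF mset_map_two_points[OF kl, of "\<lambda>i. sqrt (z i)"]])
    have as: "as y' = as y" by (auto simp: as_def y'_def)
    have y': "y' k = y k - \<delta>" "y' l = y l + \<delta>" using kl by (auto simp: y'_def)
    have "\<Phi> y \<le> \<Phi> y'"
      unfolding \<Phi> as y'
    proof (intro ternary_mean_append_mono ternary_mean_pair_mono[OF \<rho> p])
      have pos: "0 \<le> y k" "0 \<le> y l" using y kl by auto
      \<comment> \<open>The squared coefficients are the coordinates themselves: a transfer keeps
        A^2 + B^2 and lowers A^2 - B^2 by 2 \<delta>. The primed pair is the one before the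
        transfer.\<close>
      show "(sqrt (y k - \<delta>))\<^sup>2 + (sqrt (y l + \<delta>))\<^sup>2 = (sqrt (y k))\<^sup>2 + (sqrt (y l))\<^sup>2"
        "(sqrt (y k - \<delta>))\<^sup>2 - (sqrt (y l + \<delta>))\<^sup>2 \<le> (sqrt (y k))\<^sup>2 - (sqrt (y l))\<^sup>2"
        "0 \<le> sqrt (y l)" "sqrt (y l + \<delta>) \<le> sqrt (y k - \<delta>)" "0 \<le> sqrt (y l + \<delta>)"
        "sqrt (y l) \<le> sqrt (y k)"
        using \<delta> pos by auto
    qed (use \<rho> in auto)
    then show ?thesis by (simp add: y'_def)
  qed
  obtain x' where x': "mset (map x' [0..<n]) = mset (map x [0..<n])"
      "\<And>i j. i \<le> j \<Longrightarrow> j < n \<Longrightarrow> x' j \<le> x' i" "\<And>k. k \<le> n \<Longrightarrow> (\<Sum>i<k. x' i) = sum_largest n k x"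
    by (rule decreasing_rearrangement[of n x]) blast
  obtain y' where y': "mset (map y' [0..<n]) = mset (map y [0..<n])"
      "\<And>k. k \<le> n \<Longrightarrow> (\<Sum>i<k. y' i) = sum_largest n k y"
    by (rule decreasing_rearrangement[of n y]) blast
  have nonneg': "0 \<le> z' i" if "i < n" "mset (map z' [0..<n]) = mset (map z [0..<n])" "\<And>i. i < n \<Longrightarrow> 0 \<le> z i"
    for z z' :: "nat \<Rightarrow> real" and i
  proof -
    have "z' i \<in> set (map z' [0..<n])" using that(1) by simp
    also have "\<dots> = set (map z [0..<n])" using that(2) by (rule mset_eq_setD)
    finally show ?thesis using that(3) by auto
  qed
  have total: "(\<Sum>i<n. z' i) = (\<Sum>i<n. z i)" if "mset (map z' [0..<n]) = mset (map z [0..<n])"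
    for z z' :: "nat \<Rightarrow> real"
  proof -
    have "sum_list (map z' [0..<n]) = sum_list (map z [0..<n])"
      using that by (metis sum_mset_sum_list)
    then show ?thesis by (simp add: interv_sum_list_conv_sum_set_nat lessThan_atLeast0)
  qed
  have "\<Phi> y' \<le> \<Phi> x'"
  proof (rule majorisation_by_transfers[where n = n and \<Phi> = \<Phi> and x = x' and y = y'])
    show "\<Phi> a = \<Phi> b" if "\<And>i. i < n \<Longrightarrow> a i = b i" for a b
      using that by (intro perm arg_cong[where f = mset]) auto
    show "0 \<le> x' i" "0 \<le> y' i" if "i < n" for i
      using nonneg'[OF that x'(1) nonneg(1)] nonneg'[OF that y'(1) nonneg(2)] by auto
    show "(\<Sum>i<n. x' i) = (\<Sum>i<n. y' i)"
      using maj total[OF x'(1)] total[OF y'(1)] by (simp add: majorised_by_def)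
    \<comment> \<open>The empty partial sum is separate, since \<open>majorised_by\<close> starts at
      k = 1.\<close>
    show "(\<Sum>i<k. x' i) \<le> (\<Sum>i<k. y' i)" if "k \<le> n" for k
      using maj that x'(3)[OF that] y'(2)[OF that]
      by (cases "k = 0") (auto simp: majorised_by_def)
  qed (use transfer x'(2) in auto)
  then have "\<Phi> y \<le> \<Phi> x" using perm[OF x'(1)] perm[OF y'(1)] by simp
  then show ?thesis by (simp add: \<Phi>_def)
qed

section \<open>Schur-concavity of the moment norm\<close>

theorem theorem1:
  fixes M :: "'w measure" and X :: "nat \<Rightarrow> 'w \<Rightarrow> real" and \<rho>\<^sub>0 p :: real and n :: nat
  assumes "0 \<le> \<rho>\<^sub>0" and "\<rho>\<^sub>0 \<le> 1 / 2"
    and "prob_space M"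
    and "prob_space.indep_vars M (\<lambda>_. borel) X UNIV"
    and "\<And>i. measure M {\<omega> \<in> space M. X i \<omega> = 0} = \<rho>\<^sub>0"
    and "\<And>i. measure M {\<omega> \<in> space M. X i \<omega> = 1} = (1 - \<rho>\<^sub>0) / 2"
    and "\<And>i. measure M {\<omega> \<in> space M. X i \<omega> = -1} = (1 - \<rho>\<^sub>0) / 2"
    and "p \<ge> 3" and "n \<ge> 1"
  shows "schur_concave n (\<lambda>a. moment_norm M X n p (\<lambda>i. sqrt (a i)))"
  unfolding schur_concave_def
proof (intro ballI impI)
  fix x y
  assume x: "x \<in> {..<n} \<rightarrow>\<^sub>E {0..}" and y: "y \<in> {..<n} \<rightarrow>\<^sub>E {0..}" and maj: "majorised_by n x y"
  interpret prob_space M by fact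
  have "continuous_on UNIV (\<lambda>x::real. \<bar>x\<bar> powr p)"
    using assms(8) by (intro continuous_on_powr' continuous_intros) auto
  from expectation_ternary_sum[OF assms(4-7) this, of 0]
  have N: "moment_norm M X n p (\<lambda>i. sqrt (a i))
      = ternary_mean \<rho>\<^sub>0 (\<lambda>x. \<bar>x\<bar> powr p) (map (\<lambda>i. sqrt (a i)) (rev [0..<n])) 0 powr (1 / p)" for a
    by (simp add: moment_norm_def)
  \<comment> \<open>The p-th root is increasing on nonnegative numbers, so comparing the two
    averages at shift 0 suffices.\<close>
  show "moment_norm M X n p (\<lambda>i. sqrt (y i)) \<le> moment_norm M X n p (\<lambda>i. sqrt (x i))"
    unfolding N
  proof (intro powr_mono2 ternary_mean_nonneg ternary_mean_majorised maj)
    show "0 \<le> x i" "0 \<le> y i" if "i < n" for i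
      using PiE_mem[OF x, of i] PiE_mem[OF y, of i] that by auto
  qed (use assms(1,2,8) in auto)
qed

end
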